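(* Let $G$ be a connected claw-free graph. Then $G$ has an IPD if and only if $G$ has at least one block which is not a complete graph of odd order.
   Context: All graphs are finite and simple. The order of a path is its number of vertices. A path $P$ in $G$ is induced if the subgraph of $G$ induced on $V(P)$ is exactly $P$. A graph $G$ has an IPD (induced path decomposition) if $V(G)$ can be partitioned into sets $V_1,\dots,V_t$ such that each $G[V_i]$ is a path of order at least $2$ (i.e., $G$ is covered by vertex-disjoint induced paths, each with at least two vertices). A graph is claw-free if it contains no induced subgraph isomorphic to $K_{1,3}$. A block is a maximal $2$-connected subgraph (maximal connected subgraph without a cut vertex of its own); in particular a block may be $K_1$ or $K_2$. *)

theory Defs
  imports Main
begin

definition simple_graph :: "'a set \<Rightarrow> ('a \<Rightarrow> 'a \<Rightarrow> bool) \<Rightarrow> bool" where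
  "simple_graph V E \<longleftrightarrow> finite V \<and>
     (\<forall>x y. E x y \<longrightarrow> x \<in> V \<and> y \<in> V) \<and>
     (\<forall>x y. E x y \<longrightarrow> E y x) \<and> (\<forall>x. \<not> E x x)"

definition connected_on :: "('a \<Rightarrow> 'a \<Rightarrow> bool) \<Rightarrow> 'a set \<Rightarrow> bool" where
  "connected_on E S \<longleftrightarrow>
     (\<forall>x\<in>S. \<forall>y\<in>S. (\<lambda>a b. E a b \<and> a \<in> S \<and> b \<in> S)\<^sup>*\<^sup>* x y)"

definition connected_graph :: "'a set \<Rightarrow> ('a \<Rightarrow> 'a \<Rightarrow> bool) \<Rightarrow> bool" where
  "connected_graph V E \<longleftrightarrow> V \<noteq> {} \<and> connected_on E V"

definition claw_free :: "'a set \<Rightarrow> ('a \<Rightarrow> 'a \<Rightarrow> bool) \<Rightarrow> bool" where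
  "claw_free V E \<longleftrightarrow> \<not> (\<exists>a\<in>V. \<exists>b\<in>V. \<exists>c\<in>V. \<exists>d\<in>V.
      b \<noteq> c \<and> b \<noteq> d \<and> c \<noteq> d \<and>
      E a b \<and> E a c \<and> E a d \<and> \<not> E b c \<and> \<not> E b d \<and> \<not> E c d)"

definition induces_path :: "('a \<Rightarrow> 'a \<Rightarrow> bool) \<Rightarrow> 'a set \<Rightarrow> bool" where
  "induces_path E S \<longleftrightarrow> (\<exists>xs. distinct xs \<and> set xs = S \<and> length xs \<ge> 2 \<and>
      (\<forall>i<length xs. \<forall>j<length xs. E (xs ! i) (xs ! j) \<longleftrightarrow> (i = j + 1 \<or> j = i + 1)))"

definition has_IPD :: "'a set \<Rightarrow> ('a \<Rightarrow> 'a \<Rightarrow> bool) \<Rightarrow> bool" where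
  "has_IPD V E \<longleftrightarrow> (\<exists>P. \<Union>P = V \<and>
      (\<forall>A\<in>P. \<forall>B\<in>P. A \<noteq> B \<longrightarrow> A \<inter> B = {}) \<and>
      (\<forall>A\<in>P. induces_path E A))"

definition nonseparable :: "('a \<Rightarrow> 'a \<Rightarrow> bool) \<Rightarrow> 'a set \<Rightarrow> bool" where
  "nonseparable E B \<longleftrightarrow> B \<noteq> {} \<and> connected_on E B \<and>
      (\<forall>v\<in>B. connected_on E (B - {v}))"

text \<open>A block: a maximal such subgraph (blocks are induced, so we identify them with
their vertex sets).\<close>
definition is_block :: "'a set \<Rightarrow> ('a \<Rightarrow> 'a \<Rightarrow> bool) \<Rightarrow> 'a set \<Rightarrow> bool" where
  "is_block V E B \<longleftrightarrow> B \<subseteq> V \<and> nonseparable E B \<and>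
      (\<forall>B'. B \<subseteq> B' \<and> B' \<subseteq> V \<and> nonseparable E B' \<longrightarrow> B' = B)"

definition complete_on :: "('a \<Rightarrow> 'a \<Rightarrow> bool) \<Rightarrow> 'a set \<Rightarrow> bool" where
  "complete_on E B \<longleftrightarrow> (\<forall>x\<in>B. \<forall>y\<in>B. x \<noteq> y \<longrightarrow> E x y)"

end

theory Submission
  imports Defs
begin

text \<open>
  Call a graph an odd clique tree if it arises from a single vertex by repeatedly gluing an odd clique
  at one vertex; these are exactly the connected graphs all of whose blocks are odd cliques.

  Such a graph \<open>S\<close> has no IPD. Within each clique the edges of an IPD form a matching, so summing over
  the cliques an IPD has at most \<open>(|S| - 1) / 2\<close> edges, whereas covering \<open>S\<close> by paths of order at least
  two takes at least \<open>|S| / 2\<close> edges.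

  Conversely, looking at the last levels of a breadth-first search shows that a connected claw-free
  graph on at least two vertices has an edge \<open>xy\<close> such that deleting both ends leaves it connected. By induction the rest
  \<open>S\<close> has an IPD, in which case we add \<open>xy\<close>, or is an odd clique tree. In the latter case \<open>S - v\<close> has a
  perfect matching for every \<open>v\<close>, and various such matchings together with one induced path of order
  three give an IPD of the whole graph, unless \<open>x\<close> and \<open>y\<close> have the same neighbours in \<open>S\<close> and these
  form a single vertex or a whole block; then the whole graph is again an odd clique tree.
\<close>

section \<open>Perfect matchings and odd clique trees\<close>

text \<open>Only the sets that have a perfect matching matter, not the matchings themselves, so the
  covered set is the sole set argument. Its induction rule adds one edge at a time, which is how
  \<open>matchable_has_IPD\<close> builds an IPD.\<close>

inductive matchable :: "('a \<Rightarrow> 'a \<Rightarrow> bool) \<Rightarrow> 'a set \<Rightarrow> bool" for E where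
  empty: "matchable E {}"
| pair: "matchable E S \<Longrightarrow> E x y \<Longrightarrow> x \<noteq> y \<Longrightarrow> x \<notin> S \<Longrightarrow> y \<notin> S \<Longrightarrow> matchable E (insert x (insert y S))"

text \<open>The third argument records the glued cliques; a single vertex contributes none. The last
  premise of \<open>glue\<close> excludes further edges of \<open>E\<close>, so that the gluing
  describes the induced subgraph on \<open>S \<union> D\<close>. The bound on \<open>card D\<close>
  keeps a recorded clique from being the vertex \<open>a\<close> alone.\<close>

inductive odd_clique_tree :: "('a \<Rightarrow> 'a \<Rightarrow> bool) \<Rightarrow> 'a set \<Rightarrow> 'a set set \<Rightarrow> bool" for E where
  single: "odd_clique_tree E {v} {}"
| glue: "odd_clique_tree E S \<B> \<Longrightarrow> complete_on E D \<Longrightarrow> odd (card D) \<Longrightarrow> card D \<ge> 3 \<Longrightarrow>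
    D \<inter> S = {a} \<Longrightarrow> (\<And>x y. x \<in> D - {a} \<Longrightarrow> y \<in> S - {a} \<Longrightarrow> \<not> E x y) \<Longrightarrow>
    odd_clique_tree E (S \<union> D) (insert D \<B>)"

section \<open>IPDs from matchings and short induced paths\<close>

lemma has_IPD_empty: "has_IPD {} E"
  unfolding has_IPD_def by (rule exI[of _ "{}"]) simp

lemma has_IPD_Un_path:
  assumes "has_IPD S E" "induces_path E A" "A \<inter> S = {}"
  shows "has_IPD (S \<union> A) E"
proof -
  obtain P where P: "\<Union>P = S" "\<forall>A\<in>P. \<forall>B\<in>P. A \<noteq> B \<longrightarrow> A \<inter> B = {}" "\<forall>A\<in>P. induces_path E A"
    using assms(1) unfolding has_IPD_def by blast
  have "\<Union>(insert A P) = S \<union> A" using P(1) by auto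
  moreover have "\<forall>B\<in>P. A \<inter> B = {}" using P(1) assms(3) by auto
  ultimately show ?thesis
    unfolding has_IPD_def using P assms(2) by (intro exI[of _ "insert A P"]) (auto simp: Int_commute)
qed

lemma matchable_Un: "matchable E S \<Longrightarrow> matchable E T \<Longrightarrow> S \<inter> T = {} \<Longrightarrow> matchable E (S \<union> T)"
proof (induction rule: matchable.induct)
  case (pair S x y)
  then have "matchable E (insert x (insert y (S \<union> T)))" by (intro matchable.pair) auto
  then show ?case by simp
qed simp

lemma matchable_pair: "E x y \<Longrightarrow> x \<noteq> y \<Longrightarrow> matchable E {x, y}"
  using matchable.pair[OF matchable.empty, of E x y] by simp

lemma complete_on_mono: "complete_on E D \<Longrightarrow> C \<subseteq> D \<Longrightarrow> complete_on E C"
  unfolding complete_on_def by blast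

lemma matchable_complete:
  "finite D \<Longrightarrow> complete_on E D \<Longrightarrow> even (card D) \<Longrightarrow> matchable E D"
proof (induction "card D" arbitrary: D rule: less_induct)
  case less
  show ?case
  proof (cases "D = {}")
    case False
    with less.prems have "card D \<ge> 2"
      by (metis One_nat_def Suc_leI card_gt_0_iff le_neq_implies_less numeral_2_eq_2 odd_one)
    then obtain x D' where x: "D = insert x D'" "x \<notin> D'" "card D' \<ge> 1"
      by (metis Suc_1 card_le_Suc_iff)
    then obtain y D'' where y: "D' = insert y D''" "y \<notin> D''"
      by (metis card.empty equals0I mk_disjoint_insert not_one_le_zero)
    have "matchable E D''"
      using less.prems x y by (intro less.hyps) (auto elim: complete_on_mono)
    moreover have "E x y" using less.prems x y unfolding complete_on_def by auto
    ultimately show ?thesis using x y matchable.pair[of E D'' x y] by auto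
  qed (simp add: matchable.empty)
qed

text \<open>Swapping components splits \<open>F\<close> into orbits of size two. This gives the
  parity step in the edge count, where each edge occurs as two ordered pairs.\<close>

lemma even_card_sym_relation:
  "finite F \<Longrightarrow> (\<And>a b. (a, b) \<in> F \<Longrightarrow> (b, a) \<in> F \<and> a \<noteq> b) \<Longrightarrow> even (card F)"
proof (induction "card F" arbitrary: F rule: less_induct)
  case less
  show ?case
  proof (cases "F = {}")
    case False
    then obtain a b where ab: "(a, b) \<in> F" by auto
    then have ba: "(b, a) \<in> F" "(a, b) \<noteq> (b, a)" using less.prems by blast+
    let ?G = "F - {(a, b), (b, a)}"
    have c: "card F = card ?G + 2"
      using ab ba less.prems(1) card_mono[of F "{(a, b), (b, a)}"] by (simp add: card_Diff_subset)
    moreover have "even (card ?G)"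
    proof (rule less.hyps)
      show "card ?G < card F" using c by simp
      show "(q, p) \<in> ?G \<and> p \<noteq> q" if "(p, q) \<in> ?G" for p q
        using that less.prems(2)[of p q] by auto
    qed (use less.prems in simp)
    ultimately show ?thesis by simp
  qed simp
qed

text \<open>The vertex set is not a parameter, because the lemmas speak of induced subgraphs on
  varying sets for one fixed \<open>E\<close>.\<close>

locale sym_irrefl =
  fixes E :: "'a \<Rightarrow> 'a \<Rightarrow> bool"
  assumes sym: "E x y \<Longrightarrow> E y x" and irrefl: "\<not> E x x"
begin

lemma sym_iff: "E x y \<longleftrightarrow> E y x"
  using sym by blast

lemma induces_path_edge:
  assumes "E x y"
  shows "induces_path E {x, y}"
proof -
  have "E y x" "x \<noteq> y" using assms sym irrefl by blast+
  then show ?thesis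
    unfolding induces_path_def using assms irrefl
    by (intro exI[of _ "[x, y]"]) (auto simp: less_Suc_eq)
qed

lemma induces_path_three:
  assumes "E a b" "E b c" "\<not> E a c" "a \<noteq> c"
  shows "induces_path E {a, b, c}"
proof -
  have "E b a" "E c b" "\<not> E c a" "a \<noteq> b" "b \<noteq> c" using assms sym irrefl by blast+
  then show ?thesis
    unfolding induces_path_def using assms irrefl
    by (intro exI[of _ "[a, b, c]"]) (auto simp: less_Suc_eq nth_Cons)
qed

lemma matchable_has_IPD: "matchable E S \<Longrightarrow> has_IPD S E"
proof (induction rule: matchable.induct)
  case (pair S x y)
  then have "has_IPD (S \<union> {x, y}) E" by (intro has_IPD_Un_path induces_path_edge) auto
  then show ?case by simp
qed (rule has_IPD_empty)

text \<open>This is the shape of every IPD found when an edge is added to an odd clique tree: the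
  total order is odd, so one path of order three is combined with a matching.\<close>

lemma has_IPD_three:
  assumes "matchable E T" "E a b" "E b c" "\<not> E a c" "a \<noteq> c" "T \<inter> {a, b, c} = {}" "V = T \<union> {a, b, c}"
  shows "has_IPD V E"
  using has_IPD_Un_path[OF matchable_has_IPD[OF assms(1)] induces_path_three[OF assms(2-5)]] assms(6,7)
  by (simp only: Int_commute)

section \<open>Matchings inside odd clique trees\<close>

lemma odd_clique_tree_blockD:
  "odd_clique_tree E S \<B> \<Longrightarrow> D \<in> \<B> \<Longrightarrow> D \<subseteq> S \<and> complete_on E D \<and> odd (card D) \<and> card D \<ge> 3 \<and> finite D"
proof (induction rule: odd_clique_tree.induct)
  case (glue S \<B> D' a)
  then have "finite D'" by (intro card_ge_0_finite) linarith
  then show ?case using glue by (cases "D = D'") auto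
qed simp

lemma odd_clique_tree_finite: "odd_clique_tree E S \<B> \<Longrightarrow> finite S \<and> S \<noteq> {}"
proof (induction rule: odd_clique_tree.induct)
  case (glue S \<B> D a)
  then have "finite D" by (intro card_ge_0_finite) linarith
  then show ?case using glue.IH by simp
qed simp

lemma matchable_odd_clique_minus:
  assumes "complete_on E D" "odd (card D)" "a \<in> D"
  shows "matchable E (D - {a})"
proof -
  have f: "finite D" using assms(2) by (metis card.infinite even_zero)
  have "even (card (D - {a}))" using assms f by (simp add: card_Diff_singleton)
  then show ?thesis using f by (intro matchable_complete complete_on_mono[OF assms(1)]) auto
qed

lemma matchable_odd_clique_minus3:
  assumes "complete_on E D" "odd (card D)" "a \<in> D" "b \<in> D" "c \<in> D" "a \<noteq> b" "b \<noteq> c" "a \<noteq> c"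
  shows "matchable E (D - {a, b, c})"
proof -
  have f: "finite D" using assms(2) by (metis card.infinite even_zero)
  have "card {a, b, c} = 3" using assms by simp
  moreover have "card {a, b, c} \<le> card D" using f assms by (intro card_mono) auto
  ultimately have "even (card (D - {a, b, c}))"
    using f assms by (subst card_Diff_subset) auto
  then show ?thesis using f by (intro matchable_complete complete_on_mono[OF assms(1)]) auto
qed

text \<open>Odd clique trees are factor-critical. The shared vertex \<open>a\<close> is covered on
  the side that loses \<open>v\<close>; the other side then loses only \<open>a\<close>, and both
  sides are matchable.\<close>

lemma odd_clique_tree_matchable_vertex:
  "odd_clique_tree E S \<B> \<Longrightarrow> v \<in> S \<Longrightarrow> matchable E (S - {v})"
proof (induction arbitrary: v rule: odd_clique_tree.induct)
  case (single v) then show ?case by (simp add: matchable.empty)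
next
  case (glue S \<B> D a)
  have Da: "matchable E (D - {a})" using glue by (intro matchable_odd_clique_minus) auto
  show ?case
  proof (cases "v \<in> S")
    case True
    have "matchable E ((S - {v}) \<union> (D - {a}))"
      using glue True Da by (intro matchable_Un) auto
    moreover have "(S - {v}) \<union> (D - {a}) = S \<union> D - {v}" using glue True by auto
    ultimately show ?thesis by simp
  next
    case False
    then have "matchable E (D - {v})" using glue by (intro matchable_odd_clique_minus) auto
    moreover have "matchable E (S - {a})" using glue by blast
    ultimately have "matchable E ((S - {a}) \<union> (D - {v}))"
      using glue.hyps(5) by (intro matchable_Un) auto
    moreover have "(S - {a}) \<union> (D - {v}) = S \<union> D - {v}" using glue False by auto
    ultimately show ?thesis by simp
  qed
qed

text \<open>If \<open>D\<close> is the last clique glued, deleting it leaves the earlier part minus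
  the gluing vertex. A later clique only adds an even clique to what remains.\<close>

lemma odd_clique_tree_matchable_block:
  "odd_clique_tree E S \<B> \<Longrightarrow> D \<in> \<B> \<Longrightarrow> matchable E (S - D)"
proof (induction rule: odd_clique_tree.induct)
  case (glue S \<B> D' a)
  have Da: "matchable E (D' - {a})" using glue by (intro matchable_odd_clique_minus) auto
  show ?case
  proof (cases "D = D'")
    case True
    then have "S \<union> D' - D = S - {a}" using glue by auto
    then show ?thesis using odd_clique_tree_matchable_vertex[OF glue.hyps(1), of a] glue.hyps(5) by auto
  next
    case False
    then have D: "D \<in> \<B>" "D \<subseteq> S" using glue odd_clique_tree_blockD by auto
    have "matchable E ((S - D) \<union> (D' - {a}))"
      using glue D Da by (intro matchable_Un) auto
    moreover have "S \<union> D' - D = (S - D) \<union> (D' - {a})" using glue D by auto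
    ultimately show ?thesis by simp
  qed
qed simp

text \<open>When the later of the two cliques is glued, it meets everything earlier in its gluing
  vertex only; this is the vertex \<open>d\<close>. Deleting both cliques then amounts to deleting
  the earlier one from the earlier part.\<close>

lemma odd_clique_tree_two_blocks:
  "odd_clique_tree E S \<B> \<Longrightarrow> D1 \<in> \<B> \<Longrightarrow> D2 \<in> \<B> \<Longrightarrow> D1 \<noteq> D2 \<Longrightarrow> D1 \<inter> D2 \<noteq> {} \<Longrightarrow>
    matchable E (S - (D1 \<union> D2)) \<and> (\<exists>d. D1 \<inter> D2 = {d} \<and> (\<forall>x\<in>D1-{d}. \<forall>y\<in>D2-{d}. \<not> E x y))"
proof (induction rule: odd_clique_tree.induct)
  case (glue S \<B> D a)
  have new: "matchable E (S \<union> D - (D \<union> D')) \<and> (\<exists>d. D \<inter> D' = {d} \<and> (\<forall>x\<in>D-{d}. \<forall>y\<in>D'-{d}. \<not> E x y))"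
    if "D' \<in> \<B>" "D \<inter> D' \<noteq> {}" for D'
  proof -
    have D': "D' \<subseteq> S" using that glue odd_clique_tree_blockD by auto
    have a: "D \<inter> D' = {a}" using that(2) D' glue.hyps(5) by (metis Int_mono order_refl subset_singletonD)
    have "S \<union> D - (D \<union> D') = S - D'" using glue.hyps(5) a by blast
    moreover have "\<forall>x\<in>D-{a}. \<forall>y\<in>D'-{a}. \<not> E x y" using D' glue.hyps(6) by blast
    ultimately show ?thesis using odd_clique_tree_matchable_block[OF glue.hyps(1) that(1)] a by auto
  qed
  have Da: "matchable E (D - {a})" using glue by (intro matchable_odd_clique_minus) auto
  consider "D1 = D" | "D2 = D" | "D1 \<noteq> D" "D2 \<noteq> D" by blast
  then show ?case
  proof cases
    case 1
    then show ?thesis using new[of D2] glue.prems by auto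
  next
    case 2
    then have *: "D1 \<in> \<B>" "D \<inter> D1 \<noteq> {}" using glue.prems by auto
    show ?thesis using new[OF *] 2 sym_iff by (simp add: Int_commute Un_commute) blast
  next
    case 3
    then have D: "D1 \<in> \<B>" "D2 \<in> \<B>" "D1 \<subseteq> S" "D2 \<subseteq> S" using glue odd_clique_tree_blockD by auto
    have "matchable E ((S - (D1 \<union> D2)) \<union> (D - {a}))"
      using glue D Da by (intro matchable_Un) auto
    moreover have "S \<union> D - (D1 \<union> D2) = (S - (D1 \<union> D2)) \<union> (D - {a})" using glue D by auto
    ultimately show ?thesis using glue.IH glue.prems D by auto
  qed
qed simp

lemma odd_clique_tree_edge_block:
  "odd_clique_tree E S \<B> \<Longrightarrow> x \<in> S \<Longrightarrow> y \<in> S \<Longrightarrow> E x y \<Longrightarrow> \<exists>D\<in>\<B>. x \<in> D \<and> y \<in> D"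
proof (induction rule: odd_clique_tree.induct)
  case (glue S \<B> D a)
  show ?case
  proof (cases "x \<in> D \<and> y \<in> D")
    case False
    then have "x \<in> S" "y \<in> S" using glue.prems glue.hyps(6)[of x y] glue.hyps(6)[of y x] glue.hyps(5) sym by blast+
    then show ?thesis using glue.IH glue.prems by blast
  qed blast
next
  case (single v)
  then show ?case using irrefl by blast
qed

section \<open>Adding an edge to an odd clique tree\<close>

text \<open>If \<open>D\<close> is the clique glued last, enlarging it by two vertices keeps it
  complete and odd. Otherwise \<open>D\<close> lies in the earlier part; the vertices are added
  there and the last clique is glued on again at the same vertex, outside of which it does not meet
  \<open>D\<close>.\<close>

lemma odd_clique_tree_extend_block:
  "odd_clique_tree E S \<B> \<Longrightarrow> D \<in> \<B> \<Longrightarrow> x \<notin> S \<Longrightarrow> y \<notin> S \<Longrightarrow> E x y \<Longrightarrow>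
    (\<forall>v\<in>S. E v x \<longleftrightarrow> v \<in> D) \<Longrightarrow> (\<forall>v\<in>S. E v y \<longleftrightarrow> v \<in> D) \<Longrightarrow>
    \<exists>\<B>'. odd_clique_tree E (S \<union> {x, y}) \<B>'"
proof (induction rule: odd_clique_tree.induct)
  case (glue S \<B> D' a)
  have xy: "x \<noteq> y" using glue irrefl by auto
  show ?case
  proof (cases "D = D'")
    case True
    have "odd_clique_tree E (S \<union> (D \<union> {x, y})) (insert (D \<union> {x, y}) \<B>)"
    proof (rule odd_clique_tree.glue)
      show "complete_on E (D \<union> {x, y})"
        unfolding complete_on_def
      proof (intro ballI impI)
        fix p q assume "p \<in> D \<union> {x, y}" "q \<in> D \<union> {x, y}" "p \<noteq> q"
        moreover have "\<forall>v\<in>D. E v x \<and> E v y \<and> E x v \<and> E y v" using glue.prems True sym by blast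
        moreover have "E y x" using glue.prems sym by blast
        ultimately show "E p q" using glue.prems(4) glue.hyps(2) True unfolding complete_on_def by blast
      qed
      have "finite D" using glue True by (auto simp: card_ge_0_finite)
      then have c: "card (D \<union> {x, y}) = card D + 2" using glue xy True by simp
      show "odd (card (D \<union> {x, y}))" "3 \<le> card (D \<union> {x, y})" using c glue True by auto
      show "(D \<union> {x, y}) \<inter> S = {a}" using glue True by auto
      show "\<not> E p q" if "p \<in> D \<union> {x, y} - {a}" "q \<in> S - {a}" for p q
        using that glue.hyps(5) glue.hyps(6)[of p q] glue.prems(5,6) True sym_iff by blast
    qed (rule glue.hyps)
    then show ?thesis using True by (metis Un_assoc)
  next
    case False
    then have D: "D \<in> \<B>" "D \<subseteq> S" using glue odd_clique_tree_blockD by auto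
    then obtain \<B>' where B': "odd_clique_tree E (S \<union> {x, y}) \<B>'" using glue by auto
    have "odd_clique_tree E ((S \<union> {x, y}) \<union> D') (insert D' \<B>')"
      by (rule odd_clique_tree.glue[OF B', where a = a]) (use glue.hyps glue.prems D sym_iff in \<open>auto; blast\<close>)+
    then show ?thesis by (metis Un_assoc Un_commute)
  qed
qed simp

text \<open>The closure condition is what the absence of an IPD yields for the common neighbourhood
  \<open>A\<close> of the ends of an added edge. In the induction, \<open>A\<close> contains all of
  the last clique \<open>D\<close> as soon as it has two vertices in \<open>D\<close>, or one in
  \<open>S\<close> and one in \<open>D - {a}\<close>; the rest is the induction hypothesis for
  \<open>A \<inter> S\<close>.\<close>

lemma odd_clique_tree_closed_subset:
  "odd_clique_tree E S \<B> \<Longrightarrow> A \<subseteq> S \<Longrightarrow> A \<noteq> {} \<Longrightarrow>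
    (\<And>a b c. a \<in> A \<Longrightarrow> b \<in> A \<Longrightarrow> c \<in> S \<Longrightarrow> a \<noteq> b \<Longrightarrow> c \<noteq> a \<Longrightarrow> E b c \<Longrightarrow> matchable E (S - {a, b, c}) \<Longrightarrow> c \<in> A) \<Longrightarrow>
    (\<exists>a. A = {a}) \<or> A \<in> \<B> \<or> (\<exists>D1\<in>\<B>. \<exists>D2\<in>\<B>. D1 \<noteq> D2 \<and> D1 \<inter> D2 \<noteq> {} \<and> D1 \<subseteq> A \<and> D2 \<subseteq> A)"
proof (induction arbitrary: A rule: odd_clique_tree.induct)
  case (single v) then show ?case by auto
next
  case (glue S \<B> D a)
  note closed = glue.prems(3)
  have aD: "a \<in> D" "a \<in> S" using glue.hyps by auto
  have Da: "matchable E (D - {a})" "matchable E (S - {a})"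
    using glue.hyps aD odd_clique_tree_matchable_vertex
    by (auto intro: matchable_odd_clique_minus)
  have adj: "E x y" if "x \<in> D" "y \<in> D" "x \<noteq> y" for x y
    using that glue.hyps unfolding complete_on_def by auto
  \<comment> \<open>The closure condition restricts to \<open>A \<inter> S\<close> within
    \<open>S\<close>, since a matching of \<open>D - {a}\<close> completes the one given on
    \<open>S\<close>.\<close>
  have closedS: "c \<in> A \<inter> S" if "p \<in> A \<inter> S" "q \<in> A \<inter> S" "c \<in> S" "p \<noteq> q" "c \<noteq> p" "E q c" "matchable E (S - {p, q, c})" for p q c
  proof -
    have "matchable E ((S - {p, q, c}) \<union> (D - {a}))"
      using glue.hyps(5) aD Da that by (intro matchable_Un) auto
    moreover have "S \<union> D - {p, q, c} = (S - {p, q, c}) \<union> (D - {a})" using glue.hyps aD that by auto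
    ultimately show ?thesis using closed[of p q c] that by auto
  qed
  \<comment> \<open>Three vertices deleted from the odd clique \<open>D\<close> leave an even
    clique, and \<open>S - {a}\<close> is matchable whether or not \<open>a\<close> is among the
    three.\<close>
  have closedD: "c \<in> A" if "p \<in> A \<inter> D" "q \<in> A \<inter> D" "c \<in> D" "p \<noteq> q" "c \<noteq> p" "c \<noteq> q" for p q c
  proof -
    have "matchable E (D - {p, q, c})"
      using glue.hyps that by (intro matchable_odd_clique_minus3) auto
    then have "matchable E ((S - {a}) \<union> (D - {p, q, c}))"
      using glue.hyps(5) Da by (intro matchable_Un) auto
    moreover have "S \<union> D - {p, q, c} = (S - {a}) \<union> (D - {p, q, c})"
      using glue.hyps(5) aD that by auto
    ultimately show ?thesis using closed[of p q c] that adj by auto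
  qed
  have Dsub: "D \<subseteq> A" if "p \<in> A \<inter> D" "q \<in> A \<inter> D" "p \<noteq> q" for p q
    using closedD[OF that(1,2) _ that(3)] that by blast
  have Dsub': "D \<subseteq> A" if p: "p \<in> A \<inter> S" and q: "q \<in> A \<inter> (D - {a})" for p q
  proof (cases "p = a")
    case True
    then show ?thesis using Dsub[of p q] that aD by auto
  next
    case False
    \<comment> \<open>A third vertex \<open>c\<close> is chosen. With \<open>a\<close> covered
      inside \<open>S - {p}\<close>, the set \<open>D - {a, q, c}\<close> is even, so closure puts
      \<open>c\<close> into \<open>A\<close>, and then \<open>A\<close> has two vertices in
      \<open>D\<close>.\<close>
    have "\<not> D \<subseteq> {a, q}" 
      using glue.hyps(4) card_mono[of "{a, q}" D] card_insert_le_m1[of 2 "{q}" a] by auto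
    then obtain c where c: "c \<in> D" "c \<noteq> a" "c \<noteq> q" by auto
    have "matchable E (D - {a, q, c})"
      using glue.hyps aD c q by (intro matchable_odd_clique_minus3) auto
    moreover have "matchable E (S - {p})" using glue.hyps p odd_clique_tree_matchable_vertex by blast
    ultimately have "matchable E ((S - {p}) \<union> (D - {a, q, c}))"
      using glue.hyps(5) by (intro matchable_Un) auto
    moreover have "S \<union> D - {p, q, c} = (S - {p}) \<union> (D - {a, q, c})"
      using glue.hyps aD c that False by auto
    ultimately have "c \<in> A" using closed[of p q c] p q c adj[of q c] glue.hyps(5) by auto
    then show ?thesis using Dsub[of q c] q c by auto
  qed
  have IH_S: "(\<exists>a. A \<inter> S = {a}) \<or> A \<inter> S \<in> \<B> \<or>
      (\<exists>D1\<in>\<B>. \<exists>D2\<in>\<B>. D1 \<noteq> D2 \<and> D1 \<inter> D2 \<noteq> {} \<and> D1 \<subseteq> A \<inter> S \<and> D2 \<subseteq> A \<inter> S)"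
    if "A \<inter> S \<noteq> {}"
  proof (rule glue.IH)
    fix p q c
    assume "p \<in> A \<inter> S" "q \<in> A \<inter> S" "c \<in> S" "p \<noteq> q" "c \<noteq> p" "E q c" "matchable E (S - {p, q, c})"
    then show "c \<in> A \<inter> S" by (rule closedS)
  qed (use that in auto)
  show ?case
  proof (cases "A \<inter> (D - {a}) = {}")
    case True
    then have "A \<subseteq> S" using glue.prems(1) aD by auto
    then have eq: "A \<inter> S = A" by auto
    show ?thesis using IH_S[unfolded eq, OF glue.prems(2)] by blast
  next
    case False
    then obtain q where q: "q \<in> A \<inter> (D - {a})" by auto
    show ?thesis
    proof (cases "A \<inter> S = {}")
      case True
      then have "A \<subseteq> D" using glue.prems(1) by auto
      \<comment> \<open>A second vertex would force \<open>D \<subseteq> A\<close> and hence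
        \<open>a\<close> into the empty set \<open>A \<inter> S\<close>.\<close>
      then have "A = {q}" using Dsub[of q] q True aD by blast
      then show ?thesis by blast
    next
      case ne: False
      then have DA: "D \<subseteq> A" using Dsub' q by blast
      from IH_S[OF ne] consider "\<exists>p. A \<inter> S = {p}" | "A \<inter> S \<in> \<B>"
        | "\<exists>D1\<in>\<B>. \<exists>D2\<in>\<B>. D1 \<noteq> D2 \<and> D1 \<inter> D2 \<noteq> {} \<and> D1 \<subseteq> A \<and> D2 \<subseteq> A"
        by blast
      then show ?thesis
      proof cases
        case 1
        then obtain p where p: "A \<inter> S = {p}" by blast
        then have "p = a" using DA aD by auto
        then have "A \<subseteq> D" using p aD glue.prems(1) by auto
        then have "A = D" using DA by auto
        then show ?thesis by simp
      next
        case 2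
        \<comment> \<open>The old block \<open>A \<inter> S\<close> contains \<open>a\<close>,
          because \<open>D \<subseteq> A\<close>, so it meets the new block \<open>D\<close>
          there.\<close>
        moreover have "A \<inter> S \<noteq> D" "A \<inter> S \<inter> D \<noteq> {}" using q DA aD glue.hyps(5) by auto
        ultimately show ?thesis using DA by (intro disjI2 bexI[of _ "A \<inter> S"] bexI[of _ D]) auto
      qed blast
    qed
  qed
qed

text \<open>Each IPD that would arise from a path of order three restricts the neighbourhoods of
  \<open>x\<close> and \<open>y\<close>: they agree on \<open>S\<close>, and their common value
  \<open>A\<close> is closed in the sense of \<open>odd_clique_tree_closed_subset\<close>. A
  singleton \<open>A\<close> allows gluing a triangle, a block \<open>A\<close> can be enlarged, and
  two meeting blocks in \<open>A\<close> produce an IPD after all.\<close>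

lemma odd_clique_tree_add_edge:
  assumes T: "odd_clique_tree E S \<B>" and xS: "x \<notin> S" and yS: "y \<notin> S" and xy: "E x y"
    and att: "\<exists>a\<in>S. E a x \<or> E a y" and no: "\<not> has_IPD (S \<union> {x, y}) E"
  shows "\<exists>\<B>'. odd_clique_tree E (S \<union> {x, y}) \<B>'"
proof -
  have yx: "E y x" and ne: "x \<noteq> y" using xy sym irrefl by blast+
  \<comment> \<open>A vertex adjacent to exactly one end of the edge forms an induced path with both
    ends, and \<open>S - {v}\<close> is matchable.\<close>
  have twin: "E v x \<longleftrightarrow> E v y" if v: "v \<in> S" for v
  proof -
    have m: "matchable E (S - {v})" using odd_clique_tree_matchable_vertex[OF T v] .
    have "\<not> (E v x \<and> \<not> E v y)"
    proof
      assume "E v x \<and> \<not> E v y"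
      then have "has_IPD (S \<union> {x, y}) E"
        using m xy v xS yS by (intro has_IPD_three[of "S - {v}" v x y]) auto
      then show False using no by simp
    qed
    moreover have "\<not> (E v y \<and> \<not> E v x)"
    proof
      assume "E v y \<and> \<not> E v x"
      then have "has_IPD (S \<union> {x, y}) E"
        using m yx v xS yS by (intro has_IPD_three[of "S - {v}" v y x]) auto
      then show False using no by simp
    qed
    ultimately show ?thesis by blast
  qed
  define A where "A = {v \<in> S. E v x}"
  have A: "E v x" "E v y" "E x v" "E y v" "v \<in> S" if "v \<in> A" for v
    using that twin sym unfolding A_def by blast+
  have "A \<noteq> {}" using att twin unfolding A_def by blast
  moreover have "A \<subseteq> S" unfolding A_def by blast
  moreover have "c \<in> A" if a: "a \<in> A" and b: "b \<in> A" and c: "c \<in> S" and "a \<noteq> b" "c \<noteq> a" and bc: "E b c"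
    and m: "matchable E (S - {a, b, c})" for a b c
  proof (rule ccontr)
    assume "c \<notin> A"
    then have nc: "\<not> E x c" using c sym unfolding A_def by blast
    have bnc: "b \<noteq> c" using bc irrefl by blast
    \<comment> \<open>The induced path is \<open>x\<close>, \<open>b\<close>, \<open>c\<close>; the
      vertices \<open>a\<close> and \<open>y\<close> left over are adjacent and join the
      matching.\<close>
    have "matchable E ((S - {a, b, c}) \<union> {a, y})"
      using m A[OF a] yS by (intro matchable_Un matchable_pair) auto
    moreover have "((S - {a, b, c}) \<union> {a, y}) \<inter> {x, b, c} = {}"
      using xS yS ne A(5)[OF b] c \<open>a \<noteq> b\<close> \<open>c \<noteq> a\<close> A(5)[OF a] by auto
    moreover have "S \<union> {x, y} = ((S - {a, b, c}) \<union> {a, y}) \<union> {x, b, c}"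
      using A(5)[OF a] A(5)[OF b] c by auto
    moreover have "x \<noteq> c" using c xS by blast
    ultimately have "has_IPD (S \<union> {x, y}) E"
      using has_IPD_three[OF _ A(3)[OF b] bc nc] by blast
    then show False using no by simp
  qed
  ultimately consider a where "A = {a}" | "A \<in> \<B>"
    | D1 D2 where "D1 \<in> \<B>" "D2 \<in> \<B>" "D1 \<noteq> D2" "D1 \<inter> D2 \<noteq> {}" "D1 \<subseteq> A" "D2 \<subseteq> A"
    using odd_clique_tree_closed_subset[OF T, of A] by metis
  then show ?thesis
  proof cases
    case (1 a)
    note a = A[of a, unfolded 1, simplified]
    have "odd_clique_tree E (S \<union> {a, x, y}) (insert {a, x, y} \<B>)"
    proof (rule odd_clique_tree.glue[OF T])
      show "complete_on E {a, x, y}" using a xy yx unfolding complete_on_def by blast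
      have "a \<noteq> x" "a \<noteq> y" using a(5) xS yS by auto
      then have "card {a, x, y} = 3" using ne by simp
      then show "odd (card {a, x, y})" "3 \<le> card {a, x, y}" by auto
      show "{a, x, y} \<inter> S = {a}" using a(5) xS yS by auto
      show "\<not> E p q" if "p \<in> {a, x, y} - {a}" "q \<in> S - {a}" for p q
      proof -
        have "q \<in> S" "q \<notin> A" using that 1 by auto
        then have "\<not> E q x" "\<not> E q y" using twin unfolding A_def by auto
        then show ?thesis using that(1) sym by blast
      qed
    qed
    moreover have "S \<union> {a, x, y} = S \<union> {x, y}" using a(5) by auto
    ultimately show ?thesis by metis
  next
    case 2
    show ?thesis
      by (rule odd_clique_tree_extend_block[OF T 2 xS yS xy]) (use twin in \<open>auto simp: A_def\<close>)
  next
    case (3 D1 D2)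
    obtain d where m: "matchable E (S - (D1 \<union> D2))" and d: "D1 \<inter> D2 = {d}"
      and nE: "\<forall>x\<in>D1-{d}. \<forall>y\<in>D2-{d}. \<not> E x y"
      using odd_clique_tree_two_blocks[OF T 3(1-4)] by blast
    have D1: "D1 \<subseteq> S" "complete_on E D1" "odd (card D1)" "card D1 \<ge> 3"
      using odd_clique_tree_blockD[OF T 3(1)] by auto
    have D2: "D2 \<subseteq> S" "complete_on E D2" "odd (card D2)" "card D2 \<ge> 3"
      using odd_clique_tree_blockD[OF T 3(2)] by auto
    have two: "\<exists>p q. p \<in> D - {d} \<and> q \<in> D - {d} \<and> p \<noteq> q" if "card D \<ge> 3" "d \<in> D" for D :: "'a set"
    proof -
      have "card (D - {d}) \<ge> 2" using that by (simp add: card_Diff_singleton)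
      then show ?thesis by (metis card_le_Suc_iff insertCI numeral_2_eq_2)
    qed
    obtain a a' where a: "a \<in> D1 - {d}" "a' \<in> D1 - {d}" "a \<noteq> a'" using two[OF D1(4)] d by blast
    obtain b b' where b: "b \<in> D2 - {d}" "b' \<in> D2 - {d}" "b \<noteq> b'" using two[OF D2(4)] d by blast
    have dd: "d \<in> D1" "d \<in> D2" using d by auto
    have dis: "a \<notin> D2" "a' \<notin> D2" "b \<notin> D1" "b' \<notin> D1" using a b d by auto
    have inA: "a \<in> A" "a' \<in> A" "b \<in> A" using 3 a b by auto
    \<comment> \<open>The path is \<open>a\<close>, \<open>x\<close>, \<open>b\<close> with ends in
      different blocks. Then \<open>y\<close> is matched to \<open>a'\<close> and \<open>d\<close>
      to \<open>b'\<close>, so each clique loses three vertices and an even rest.\<close>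
    let ?M = "(S - (D1 \<union> D2)) \<union> ((D1 - {d, a, a'}) \<union> ((D2 - {d, b, b'}) \<union> ({a', y} \<union> {d, b'})))"
    have 1: "matchable E {a', y}" using A(2)[OF inA(2)] A(5)[OF inA(2)] yS by (intro matchable_pair) auto
    have 2: "matchable E {d, b'}" using D2(2) dd b unfolding complete_on_def by (intro matchable_pair) auto
    have 3: "matchable E (D1 - {d, a, a'})" "matchable E (D2 - {d, b, b'})"
      using matchable_odd_clique_minus3[OF D1(2,3) dd(1), of a a'] matchable_odd_clique_minus3[OF D2(2,3) dd(2), of b b'] a b
      by auto
    have 4: "matchable E ({a', y} \<union> {d, b'})"
      using dis a b dd D2(1) yS by (intro matchable_Un[OF 1 2]) auto
    have 5: "matchable E ((D2 - {d, b, b'}) \<union> ({a', y} \<union> {d, b'}))"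
      using dis a b dd D2(1) yS by (intro matchable_Un[OF 3(2) 4]) auto
    have 6: "matchable E ((D1 - {d, a, a'}) \<union> ((D2 - {d, b, b'}) \<union> ({a', y} \<union> {d, b'})))"
      using dis a b d D1(1) yS by (intro matchable_Un[OF 3(1) 5]) auto
    have 7: "matchable E ?M"
      using a b dd D1(1) yS by (intro matchable_Un[OF m 6]) auto
    have "has_IPD (S \<union> {x, y}) E"
    proof (rule has_IPD_three[OF 7, of a x b])
      show "E a x" "E x b" using A inA by auto
      show "\<not> E a b" using nE a b by blast
      show "a \<noteq> b" using dis b by auto
      show "?M \<inter> {a, x, b} = {}" using a b dis dd xS yS ne D1(1) D2(1) by auto
      show "S \<union> {x, y} = ?M \<union> {a, x, b}" using a b dd D1(1) D2(1) by auto
    qed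
    then show ?thesis using no by simp
  qed
qed

section \<open>A removable edge in a connected claw-free graph\<close>

lemma connected_on_crossing_edge:
  assumes "connected_on E W" "S \<subseteq> W" "S \<noteq> {}" "S \<noteq> W"
  shows "\<exists>a\<in>S. \<exists>b\<in>W - S. E a b"
proof (rule ccontr)
  assume no: "\<not> ?thesis"
  obtain s t where st: "s \<in> S" "t \<in> W" "t \<notin> S" using assms by blast
  then have "(\<lambda>a b. E a b \<and> a \<in> W \<and> b \<in> W)\<^sup>*\<^sup>* s t"
    using assms(1,2) unfolding connected_on_def by blast
  then have "t \<in> S" by (induction rule: rtranclp_induct) (use st no in auto)
  then show False using st by simp
qed

text \<open>Following neighbours of smaller value leads from every vertex to \<open>r\<close>. With
  \<open>f\<close> a breadth-first level, this shows that a deletion preserves connectedness: each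
  remaining vertex must only keep some parent.\<close>

lemma connected_on_descending:
  fixes f :: "'a \<Rightarrow> nat"
  assumes r: "r \<in> W" and desc: "\<And>v. v \<in> W \<Longrightarrow> v \<noteq> r \<Longrightarrow> \<exists>u\<in>W. E u v \<and> f u < f v"
  shows "connected_on E W"
proof -
  let ?R = "\<lambda>a b. E a b \<and> a \<in> W \<and> b \<in> W"
  have to: "?R\<^sup>*\<^sup>* v r \<and> ?R\<^sup>*\<^sup>* r v" if "v \<in> W" for v
    using that
  proof (induction "f v" arbitrary: v rule: less_induct)
    case less
    show ?case
    proof (cases "v = r")
      case False
      then obtain u where u: "u \<in> W" "E u v" "f u < f v" using desc less.prems by blast
      then have "?R\<^sup>*\<^sup>* u r" "?R\<^sup>*\<^sup>* r u" using less.hyps by blast+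
      moreover have "?R v u" "?R u v" using u less.prems sym by blast+
      ultimately show ?thesis
        using converse_rtranclp_into_rtranclp[of ?R v u r] rtranclp.rtrancl_into_rtrancl[of ?R r u v] by blast
    qed simp
  qed
  then show ?thesis unfolding connected_on_def by (meson rtranclp_trans)
qed

text \<open>The function is the distance from \<open>r\<close> within \<open>W\<close>; the last
  vertex before \<open>v\<close> on a shortest walk is its parent.\<close>

lemma connected_on_levels:
  assumes con: "connected_on E W" and r: "r \<in> W"
  obtains f :: "'a \<Rightarrow> nat" where "f r = 0"
    "\<And>v. v \<in> W \<Longrightarrow> v \<noteq> r \<Longrightarrow> \<exists>u\<in>W. E u v \<and> f v = Suc (f u)"
    "\<And>u v. u \<in> W \<Longrightarrow> v \<in> W \<Longrightarrow> E u v \<Longrightarrow> f v \<le> Suc (f u)"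
proof -
  define R where "R = (\<lambda>a b. E a b \<and> a \<in> W \<and> b \<in> W)"
  define f where "f v = (LEAST n. (R ^^ n) r v)" for v
  have reach: "(R ^^ f v) r v" if "v \<in> W" for v
  proof -
    have "R\<^sup>*\<^sup>* r v" using con r that unfolding connected_on_def R_def by blast
    then show ?thesis unfolding f_def by (meson LeastI rtranclp_imp_relpowp)
  qed
  have least: "f v \<le> n" if "(R ^^ n) r v" for v n
    unfolding f_def using that by (rule Least_le)
  have "f r = 0" using least[of 0 r] by simp
  moreover have step: "f v \<le> Suc (f u)" if "u \<in> W" "v \<in> W" "E u v" for u v
    using reach[OF that(1)] that by (intro least relpowp_Suc_I) (auto simp: R_def)
  moreover have "\<exists>u\<in>W. E u v \<and> f v = Suc (f u)" if v: "v \<in> W" "v \<noteq> r" for v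
  proof (cases "f v")
    case 0
    then show ?thesis using reach[OF v(1)] v by simp
  next
    case (Suc k)
    then obtain u where u: "(R ^^ k) r u" "R u v" using reach[OF v(1)] by (metis relpowp_Suc_E)
    then have "f u \<le> k" "u \<in> W" "E u v" using least by (auto simp: R_def)
    then show ?thesis using step[of u v] v Suc by force
  qed
  ultimately show ?thesis using that by blast
qed

text \<open>Let \<open>x\<close> lie in the last level, with parent \<open>y\<close> and grandparent
  \<open>p\<close>. If \<open>y\<close> has another child \<open>z\<close> there, claw-freeness at
  \<open>y\<close> makes \<open>x\<close> and \<open>z\<close> adjacent, and both are leaves of the
  search; if not, \<open>y\<close> is parent to \<open>x\<close> alone and the edge between them can
  go. With at most two levels, \<open>r\<close> is adjacent to everything and is either avoided or
  the centre of a star.\<close>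

lemma claw_free_removable_edge:
  assumes fin: "finite W" and con: "connected_on E W" and claw: "claw_free W E" and card: "card W \<ge> 2"
  shows "\<exists>x\<in>W. \<exists>y\<in>W. E x y \<and> connected_on E (W - {x, y})"
proof -
  have adj: "E b c \<or> E b d \<or> E c d"
    if "a \<in> W" "b \<in> W" "c \<in> W" "d \<in> W" "b \<noteq> c" "b \<noteq> d" "c \<noteq> d" "E a b" "E a c" "E a d" for a b c d
    using claw that unfolding claw_free_def by blast
  obtain r where r: "r \<in> W" using card by fastforce
  obtain f where f0: "f r = 0"
    and par: "\<And>v. v \<in> W \<Longrightarrow> v \<noteq> r \<Longrightarrow> \<exists>u\<in>W. E u v \<and> f v = Suc (f u)"
    and lip: "\<And>u v. u \<in> W \<Longrightarrow> v \<in> W \<Longrightarrow> E u v \<Longrightarrow> f v \<le> Suc (f u)"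
    using connected_on_levels[OF con r] by metis
  define d where "d = Max (f ` W)"
  have le: "f v \<le> d" if "v \<in> W" for v using that fin unfolding d_def by simp
  have "d \<in> f ` W" unfolding d_def using fin r by (intro Max_in) auto
  then obtain x where x: "x \<in> W" "f x = d" by blast
  show ?thesis
  proof (cases "d \<ge> 2")
    case True
    then obtain y where y: "y \<in> W" "E y x" "d = Suc (f y)" using par[of x] x f0 by force
    then obtain p where p: "p \<in> W" "E p y" "f y = Suc (f p)" using par[of y] True f0 by force
    show ?thesis
    proof (cases "\<exists>z\<in>W. z \<noteq> x \<and> E y z \<and> f z = d")
      case True
      then obtain z where z: "z \<in> W" "z \<noteq> x" "E y z" "f z = d" by blast
      \<comment> \<open>An edge joins levels at most one apart, while \<open>x\<close> and
        \<open>z\<close> lie two levels below \<open>p\<close>.\<close>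
      have "\<not> E p x" "\<not> E p z" using lip[of p x] lip[of p z] p x y z by auto
      then have xz: "E x z" using adj[of y p x z] p x y z sym by force
      have "connected_on E (W - {x, z})"
      proof (rule connected_on_descending[of r _ f])
        show "r \<in> W - {x, z}" using r x z f0 \<open>d \<ge> 2\<close> by auto
        fix v assume v: "v \<in> W - {x, z}" "v \<noteq> r"
        then obtain u where u: "u \<in> W" "E u v" "f v = Suc (f u)" using par by blast
        then have "u \<noteq> x" "u \<noteq> z" using le[of v] v x z by auto
        then show "\<exists>u\<in>W - {x, z}. E u v \<and> f u < f v" using u by auto
      qed
      then show ?thesis using x z xz by blast
    next
      case False
      have "connected_on E (W - {y, x})"
      proof (rule connected_on_descending[of r _ f])
        show "r \<in> W - {y, x}" using r x y f0 \<open>d \<ge> 2\<close> by auto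
        fix v assume v: "v \<in> W - {y, x}" "v \<noteq> r"
        then obtain u where u: "u \<in> W" "E u v" "f v = Suc (f u)" using par by blast
        then have "u \<noteq> x" using le[of v] v x by auto
        moreover have "u \<noteq> y" using u y v False by auto
        ultimately show "\<exists>u\<in>W - {y, x}. E u v \<and> f u < f v" using u by auto
      qed
      then show ?thesis using x y by blast
    qed
  next
    case False
    have rv: "E r v \<and> f v = 1" if v: "v \<in> W" "v \<noteq> r" for v
    proof -
      obtain u where u: "u \<in> W" "E u v" "f v = Suc (f u)" using par[OF v] by blast
      then have "f u = 0" using le[OF v(1)] False by simp
      then have "u = r" using par[OF u(1)] by force
      then show ?thesis using u \<open>f u = 0\<close> by auto
    qed
    show ?thesis
    proof (cases "\<exists>x\<in>W - {r}. \<exists>y\<in>W - {r}. E x y")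
      case True
      then obtain x y where xy: "x \<in> W - {r}" "y \<in> W - {r}" "E x y" by blast
      have "connected_on E (W - {x, y})"
      proof (rule connected_on_descending[of r _ f])
        show "r \<in> W - {x, y}" using r xy by auto
        show "\<exists>u\<in>W - {x, y}. E u v \<and> f u < f v" if "v \<in> W - {x, y}" "v \<noteq> r" for v
          using that rv[of v] f0 \<open>r \<in> W - {x, y}\<close> by auto
      qed
      then show ?thesis using xy by blast
    next
      case no: False
      have "W \<noteq> {r}" using card by auto
      then obtain x where x: "x \<in> W" "x \<noteq> r" using r by blast
      \<comment> \<open>The other vertices form an independent set, so \<open>x\<close> and two more
        of them would be a claw at \<open>r\<close>.\<close>
      have "p = q" if "p \<in> W - {r, x}" "q \<in> W - {r, x}" for p q
        using adj[of r x p q] rv that x r no by blast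
      then have "connected_on E (W - {r, x})" unfolding connected_on_def by blast
      then show ?thesis using x r rv by blast
    qed
  qed
qed

text \<open>Deleting a removable edge keeps the graph connected and claw-free, so the induction
  hypothesis applies unless nothing is left.\<close>

lemma claw_free_has_IPD_or_tree:
  "finite W \<Longrightarrow> W \<noteq> {} \<Longrightarrow> connected_on E W \<Longrightarrow> claw_free W E \<Longrightarrow>
    has_IPD W E \<or> (\<exists>\<B>. odd_clique_tree E W \<B>)"
proof (induction "card W" arbitrary: W rule: less_induct)
  case less
  show ?case
  proof (cases "card W \<ge> 2")
    case False
    then have "card W = 1" using less.prems by (metis One_nat_def Suc_1 Suc_leI card_gt_0_iff le_neq_implies_less)
    then obtain v where "W = {v}" by (rule card_1_singletonE)
    then show ?thesis using odd_clique_tree.single[of E v] by auto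
  next
    case True
    then obtain x y where xy: "x \<in> W" "y \<in> W" "E x y" and con: "connected_on E (W - {x, y})"
      using claw_free_removable_edge less.prems by blast
    define S where "S = W - {x, y}"
    have W: "W = S \<union> {x, y}" "x \<notin> S" "y \<notin> S" using xy unfolding S_def by auto
    show ?thesis
    proof (cases "S = {}")
      case True
      then show ?thesis
        using has_IPD_Un_path[OF has_IPD_empty induces_path_edge[OF xy(3)]] W(1) by simp
    next
      case False
      have "claw_free S E" using less.prems(4) W(1) unfolding claw_free_def by blast
      moreover have "card S < card W" using less.prems(1) xy unfolding S_def by (intro psubset_card_mono) auto
      ultimately consider "has_IPD S E" | \<B> where "odd_clique_tree E S \<B>"
        using less.hyps[of S] con less.prems(1) False unfolding S_def by blast
      then show ?thesis
      proof cases
        case 1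
        then show ?thesis using has_IPD_Un_path[OF 1 induces_path_edge[OF xy(3)]] W by simp
      next
        case (2 \<B>)
        have "\<exists>a\<in>S. E a x \<or> E a y"
          using connected_on_crossing_edge[OF less.prems(3), of S] False W by blast
        then show ?thesis using odd_clique_tree_add_edge[OF 2 W(2,3) xy(3)] W(1) by blast
      qed
    qed
  qed
qed

section \<open>Blocks of an odd clique tree\<close>

lemma complete_on_connected_on: "complete_on E D \<Longrightarrow> connected_on E D"
  unfolding connected_on_def complete_on_def by (metis (mono_tags, lifting) r_into_rtranclp rtranclp.rtrancl_refl)

lemma complete_on_nonseparable: "complete_on E D \<Longrightarrow> D \<noteq> {} \<Longrightarrow> nonseparable E D"
  unfolding nonseparable_def by (auto intro: complete_on_connected_on complete_on_mono)

lemma nonseparable_connected_minus: "nonseparable E B \<Longrightarrow> connected_on E (B - {v})"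
  unfolding nonseparable_def by (cases "v \<in> B") auto

text \<open>The gluing vertex \<open>a\<close> separates \<open>S\<close> from \<open>D\<close>, so
  a block lies on one side. On the side of \<open>S\<close> it is a block of the smaller tree; on
  the side of \<open>D\<close> maximality makes it equal to \<open>D\<close>.\<close>

lemma odd_clique_tree_block:
  "odd_clique_tree E S \<B> \<Longrightarrow> is_block S E C \<Longrightarrow> complete_on E C \<and> odd (card C)"
proof (induction rule: odd_clique_tree.induct)
  case (single v)
  then have "C = {v}" unfolding is_block_def nonseparable_def by auto
  then show ?case by (simp add: complete_on_def)
next
  case (glue S \<B> D a)
  have C: "C \<subseteq> S \<union> D" "nonseparable E C" using glue.prems unfolding is_block_def by auto
  have "C \<subseteq> S \<or> C \<subseteq> D"
  proof (rule ccontr)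
    assume no: "\<not> (C \<subseteq> S \<or> C \<subseteq> D)"
    let ?W = "C - {a}"
    have "connected_on E ?W" using C nonseparable_connected_minus by blast
    moreover have "a \<in> D" "a \<in> S" using glue.hyps(5) by auto
    obtain p q where "p \<in> C" "p \<notin> D" "q \<in> C" "q \<notin> S" using no by blast
    then have "p \<in> ?W \<inter> S" "q \<in> ?W - S" using C(1) \<open>a \<in> D\<close> \<open>a \<in> S\<close> by auto
    then have "?W \<inter> S \<noteq> {}" "?W \<inter> S \<noteq> ?W" by blast+
    ultimately obtain p q where pq: "p \<in> ?W \<inter> S" "q \<in> ?W - ?W \<inter> S" "E p q"
      using connected_on_crossing_edge[of ?W "?W \<inter> S"] by blast
    then have "\<not> E q p" using glue.hyps(6)[of q p] C(1) by auto
    then show False using pq sym by blast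
  qed
  then show ?case
  proof
    assume "C \<subseteq> S"
    then have "is_block S E C" using glue.prems unfolding is_block_def by blast
    then show ?thesis using glue.IH by blast
  next
    assume "C \<subseteq> D"
    moreover have "nonseparable E D" using glue.hyps by (intro complete_on_nonseparable) auto
    ultimately have "D = C" using glue.prems unfolding is_block_def by blast
    then show ?thesis using glue.hyps by blast
  qed
qed

section \<open>Counting edges: odd clique trees have no IPD\<close>

text \<open>\<open>F\<close> holds each edge in both directions. Two partners of one vertex are
  never adjacent, so inside a clique \<open>F\<close> is a matching, and in an odd clique it misses
  a vertex. The bounds add up because gluing identifies exactly one vertex.\<close>

lemma odd_clique_tree_card_induced:
  "odd_clique_tree E S \<B> \<Longrightarrow> F \<subseteq> S \<times> S \<Longrightarrow> (\<And>a b. (a, b) \<in> F \<Longrightarrow> (b, a) \<in> F \<and> E a b) \<Longrightarrow>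
    (\<And>a b c. (a, b) \<in> F \<Longrightarrow> (a, c) \<in> F \<Longrightarrow> b \<noteq> c \<Longrightarrow> \<not> E b c) \<Longrightarrow> card F < card S"
proof (induction arbitrary: F rule: odd_clique_tree.induct)
  case (single v)
  have "F = {}" using single.prems(1,2) irrefl by fast
  then show ?case by simp
next
  case (glue S \<B> D a)
  have fS: "finite S" using odd_clique_tree_finite[OF glue.hyps(1)] by blast
  have fD: "finite D" using glue.hyps(4) by (intro card_ge_0_finite) linarith
  let ?G = "F \<inter> D \<times> D"
  have "card (F \<inter> S \<times> S) < card S"
  proof (rule glue.IH)
    show "(q, p) \<in> F \<inter> S \<times> S \<and> E p q" if "(p, q) \<in> F \<inter> S \<times> S" for p q
      using that glue.prems(2)[of p q] by auto
    show "\<not> E q c" if "(p, q) \<in> F \<inter> S \<times> S" "(p, c) \<in> F \<inter> S \<times> S" "q \<noteq> c" for p q c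
      using that glue.prems(3)[of p q c] by auto
  qed simp
  moreover have "card ?G < card D"
  proof -
    have "inj_on fst ?G"
    proof (rule inj_onI)
      fix e e' assume e: "e \<in> ?G" "e' \<in> ?G" "fst e = fst e'"
      obtain p q q' where pq: "e = (p, q)" "e' = (p, q')" using e(3) by (metis prod.collapse)
      have "q = q'"
      proof (rule ccontr)
        assume "q \<noteq> q'"
        then have "\<not> E q q'" using glue.prems(3)[of p q q'] e pq by auto
        then show False using glue.hyps(2) e pq \<open>q \<noteq> q'\<close> unfolding complete_on_def by auto
      qed
      then show "e = e'" using pq by simp
    qed
    then have "card ?G \<le> card D" by (rule card_inj_on_le) (use fD in auto)
    \<comment> \<open>Parity sharpens the bound by the odd number \<open>card D\<close> to a strict
      one.\<close>
    moreover have "even (card ?G)"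
    proof (rule even_card_sym_relation)
      show "finite ?G" using fD by simp
      show "(q, p) \<in> ?G \<and> p \<noteq> q" if "(p, q) \<in> ?G" for p q
        using that glue.prems(2)[of p q] irrefl by auto
    qed
    ultimately show ?thesis using glue.hyps(3) by (metis le_neq_implies_less)
  qed
  moreover have "card F \<le> card (F \<inter> S \<times> S) + card ?G"
  proof -
    have "F \<subseteq> (F \<inter> S \<times> S) \<union> ?G"
    proof
      fix e assume e: "e \<in> F"
      obtain p q where pq: "e = (p, q)" by fastforce
      have "p \<in> S \<union> D" "q \<in> S \<union> D" "E p q" "E q p" using glue.prems(1) glue.prems(2)[of p q] sym e pq by auto
      then have "p \<in> S \<and> q \<in> S \<or> p \<in> D \<and> q \<in> D"
        using glue.hyps(6)[of p q] glue.hyps(6)[of q p] glue.hyps(5) by blast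
      then show "e \<in> (F \<inter> S \<times> S) \<union> ?G" using e pq by auto
    qed
    then have "card F \<le> card ((F \<inter> S \<times> S) \<union> ?G)" using fS fD by (intro card_mono) auto
    then show ?thesis using card_Un_le le_trans by blast
  qed
  moreover have "card S + card D = card (S \<union> D) + 1"
    using card_Un_Int[OF fS fD] glue.hyps(5) by (simp add: Int_commute)
  ultimately show ?case by linarith
qed

text \<open>The ordered pairs along the paths of an IPD satisfy the preceding count, so there are
  fewer of them than vertices. Yet every vertex has a neighbour on its path and is a first
  component.\<close>

lemma odd_clique_tree_no_IPD:
  assumes T: "odd_clique_tree E V \<B>"
  shows "\<not> has_IPD V E"
proof
  assume "has_IPD V E"
  then obtain P where P: "\<Union>P = V" "\<forall>A\<in>P. \<forall>B\<in>P. A \<noteq> B \<longrightarrow> A \<inter> B = {}"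
      "\<forall>A\<in>P. induces_path E A"
    unfolding has_IPD_def by (elim exE conjE)
  define F where "F = {(x, y). E x y \<and> (\<exists>A\<in>P. x \<in> A \<and> y \<in> A)}"
  have sub: "F \<subseteq> V \<times> V" unfolding F_def using P(1) by auto
  have "card F < card V"
  proof (rule odd_clique_tree_card_induced[OF T sub])
    show "(b, a) \<in> F \<and> E a b" if "(a, b) \<in> F" for a b using that sym unfolding F_def by auto
    show "\<not> E b c" if ab: "(a, b) \<in> F" and ac: "(a, c) \<in> F" and "b \<noteq> c" for a b c
    proof -
      obtain A where A: "A \<in> P" "a \<in> A" "b \<in> A" "E a b" using ab unfolding F_def by blast
      obtain B where B: "B \<in> P" "a \<in> B" "c \<in> B" "E a c" using ac unfolding F_def by blast
      have "A = B" using P(2) A B by blast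
      obtain xs where xs: "set xs = A"
        "\<And>i j. i < length xs \<Longrightarrow> j < length xs \<Longrightarrow> E (xs ! i) (xs ! j) \<longleftrightarrow> i = j + 1 \<or> j = i + 1"
        using bspec[OF P(3) A(1)] unfolding induces_path_def by blast
      obtain i j k where ijk: "i < length xs" "j < length xs" "k < length xs" "xs ! i = a" "xs ! j = b" "xs ! k = c"
        using A B xs(1) \<open>A = B\<close> by (metis in_set_conv_nth)
      \<comment> \<open>Two distinct positions next to \<open>i\<close> differ by two, hence carry
        nonadjacent vertices.\<close>
      have "j \<noteq> k" using ijk \<open>b \<noteq> c\<close> by auto
      moreover have "i = j + 1 \<or> j = i + 1" "i = k + 1 \<or> k = i + 1"
        using xs(2)[of i j] xs(2)[of i k] ijk A B by auto
      ultimately show ?thesis using xs(2)[of j k] ijk by auto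
    qed
  qed
  moreover have "V \<subseteq> fst ` F"
  proof
    fix v assume "v \<in> V"
    then obtain A where A: "A \<in> P" "v \<in> A" using P(1) by blast
    obtain xs where xs: "set xs = A" "length xs \<ge> 2"
      "\<And>i j. i < length xs \<Longrightarrow> j < length xs \<Longrightarrow> E (xs ! i) (xs ! j) \<longleftrightarrow> i = j + 1 \<or> j = i + 1"
      using bspec[OF P(3) A(1)] unfolding induces_path_def by blast
    obtain i where i: "i < length xs" "xs ! i = v" using A xs(1) by (metis in_set_conv_nth)
    \<comment> \<open>The predecessor serves as neighbour, except at the start of the path, where
      the bound on the length provides a successor.\<close>
    define j where "j = (if i = 0 then 1 else i - 1)"
    have "j < length xs" "i = j + 1 \<or> j = i + 1" using i xs(2) unfolding j_def by auto
    then have "E v (xs ! j)" "xs ! j \<in> A" using xs(3)[OF i(1), of j] i xs(1) by auto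
    then have "(v, xs ! j) \<in> F" unfolding F_def using A by blast
    then show "v \<in> fst ` F" by force
  qed
  moreover have "finite F" using sub odd_clique_tree_finite[OF T] by (meson finite_SigmaI finite_subset)
  ultimately show False by (meson card_image_le card_mono finite_imageI le_trans not_le)
qed

section \<open>Nonseparable sets and assembling a graph from its blocks\<close>

lemma connected_on_Un:
  assumes "connected_on E A" "connected_on E B" "A \<inter> B \<noteq> {}"
  shows "connected_on E (A \<union> B)"
proof -
  let ?R = "\<lambda>S a b. E a b \<and> a \<in> S \<and> b \<in> S"
  obtain c where c: "c \<in> A" "c \<in> B" using assms(3) by blast
  have mono: "(?R (A \<union> B))\<^sup>*\<^sup>* x y" if "(?R S)\<^sup>*\<^sup>* x y" "S \<subseteq> A \<union> B" for S x y
    using that(1) by (rule rtranclp_mono[THEN predicate2D, rotated]) (use that(2) in auto)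
  have "(?R (A \<union> B))\<^sup>*\<^sup>* x c \<and> (?R (A \<union> B))\<^sup>*\<^sup>* c x" if "x \<in> A \<union> B" for x
  proof (cases "x \<in> A")
    case True
    then have "(?R A)\<^sup>*\<^sup>* x c" "(?R A)\<^sup>*\<^sup>* c x" using assms(1) c unfolding connected_on_def by blast+
    then show ?thesis using mono[of A] by blast
  next
    case False
    then have "(?R B)\<^sup>*\<^sup>* x c" "(?R B)\<^sup>*\<^sup>* c x" using assms(2) c that unfolding connected_on_def by blast+
    then show ?thesis using mono[of B] by blast
  qed
  then show ?thesis unfolding connected_on_def by (meson rtranclp_trans)
qed

lemma edge_complete_on: "E x y \<Longrightarrow> complete_on E {x, y}"
  using sym unfolding complete_on_def by blast

text \<open>The vertices are added one by one. The walks attached below start inside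
  \<open>C\<close>; the second alternative is what remains true of the tail during the
  induction.\<close>

lemma connected_on_attach_walk:
  "connected_on E C \<Longrightarrow> successively E ys \<Longrightarrow> (ys \<noteq> [] \<Longrightarrow> hd ys \<in> C \<or> (\<exists>c\<in>C. E c (hd ys))) \<Longrightarrow>
    connected_on E (C \<union> set ys)"
proof (induction ys arbitrary: C)
  case (Cons y ys)
  have "connected_on E (insert y C)"
  proof (cases "y \<in> C")
    case True
    then show ?thesis using Cons.prems(1) by (simp add: insert_absorb)
  next
    case False
    then obtain c where c: "c \<in> C" "E c y" using Cons.prems(3) by auto
    then have "connected_on E (C \<union> {c, y})"
      using connected_on_Un[OF Cons.prems(1) complete_on_connected_on[OF edge_complete_on[OF c(2)]]] by blast
    moreover have "C \<union> {c, y} = insert y C" using c by auto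
    ultimately show ?thesis by simp
  qed
  moreover have "successively E ys" "ys \<noteq> [] \<Longrightarrow> E y (hd ys)"
    using Cons.prems(2) by (cases ys; simp)+
  ultimately have "connected_on E (insert y C \<union> set ys)" by (intro Cons.IH) auto
  then show ?case by simp
qed simp

text \<open>If a vertex of the ear is deleted, the two pieces of the ear still hang on
  \<open>D\<close> by their outer ends, or are empty.\<close>

lemma nonseparable_Un_ear:
  assumes D: "nonseparable E D" and xs: "distinct xs" "successively E xs" "xs \<noteq> []" "hd xs \<in> D" "last xs \<in> D"
  shows "nonseparable E (D \<union> set xs)"
  unfolding nonseparable_def
proof (intro conjI ballI)
  show "D \<union> set xs \<noteq> {}" using xs by auto
  show "connected_on E (D \<union> set xs)"
    using D xs unfolding nonseparable_def by (intro connected_on_attach_walk) auto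
  fix z
  have C: "connected_on E (D - {z})" using D nonseparable_connected_minus by blast
  show "connected_on E (D \<union> set xs - {z})"
  proof (cases "z \<in> set xs")
    case False
    then have "connected_on E ((D - {z}) \<union> set xs)"
      using C xs by (intro connected_on_attach_walk) auto
    moreover have "(D - {z}) \<union> set xs = D \<union> set xs - {z}" using False by auto
    ultimately show ?thesis by simp
  next
    case True
    then obtain as bs where s: "xs = as @ z # bs" by (meson split_list)
    have sa: "successively E as" "successively E bs" using xs(2) s
      by (auto simp: successively_append_iff successively_Cons)
    \<comment> \<open>The second piece is read backwards, so that it starts at the end lying in
      \<open>D\<close>.\<close>
    have "(\<lambda>x y. E y x) = E" using sym by blast
    then have sb: "successively E (rev bs)" using sa(2) by (simp only: successively_rev)
    have "connected_on E ((D - {z}) \<union> set as)"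
      using C sa xs(1,4) s by (intro connected_on_attach_walk) (auto simp: hd_append)
    then have "connected_on E ((D - {z}) \<union> set as \<union> set (rev bs))"
      by (rule connected_on_attach_walk[OF _ sb]) (use xs(1,5) s in \<open>auto simp: hd_rev split: if_splits\<close>)
    moreover have "(D - {z}) \<union> set as \<union> set (rev bs) = D \<union> set xs - {z}" using s xs(1) by auto
    ultimately show ?thesis by simp
  qed
qed

text \<open>With two common vertices, one survives the deletion of any vertex and links both
  sides.\<close>

lemma nonseparable_Un:
  assumes "nonseparable E A" "nonseparable E B" "s \<in> A \<inter> B" "t \<in> A \<inter> B" "s \<noteq> t"
  shows "nonseparable E (A \<union> B)"
  unfolding nonseparable_def
proof (intro conjI ballI)
  show "A \<union> B \<noteq> {}" using assms by auto
  show "connected_on E (A \<union> B)"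
    using assms unfolding nonseparable_def by (intro connected_on_Un) auto
  fix z
  have "connected_on E ((A - {z}) \<union> (B - {z}))"
    using assms by (intro connected_on_Un nonseparable_connected_minus) auto
  then show "connected_on E (A \<union> B - {z})" by (simp add: Un_Diff)
qed

lemma connected_on_path:
  assumes "connected_on E S" "x \<in> S" "y \<in> S"
  obtains xs where "distinct xs" "successively E xs" "xs \<noteq> []" "hd xs = x" "last xs = y" "set xs \<subseteq> S"
proof -
  have "(\<lambda>a b. E a b \<and> a \<in> S \<and> b \<in> S)\<^sup>*\<^sup>* x y" using assms unfolding connected_on_def by blast
  then have "\<exists>xs. distinct xs \<and> successively E xs \<and> xs \<noteq> [] \<and> hd xs = x \<and> last xs = y \<and> set xs \<subseteq> S"
  proof (induction rule: converse_rtranclp_induct)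
    case base
    show ?case using assms(3) by (intro exI[of _ "[y]"]) auto
  next
    case (step u v)
    then obtain xs where xs: "distinct xs" "successively E xs" "xs \<noteq> []" "hd xs = v" "last xs = y" "set xs \<subseteq> S"
      by blast
    show ?case
    proof (cases "u \<in> set xs")
      case True
      \<comment> \<open>When \<open>u\<close> already lies on the path, the part from
        \<open>u\<close> on is kept.\<close>
      then obtain as bs where "xs = as @ u # bs" by (meson split_list)
      then show ?thesis using xs by (intro exI[of _ "u # bs"]) (auto simp: successively_append_iff)
    next
      case False
      then show ?thesis using xs step.hyps(1) by (intro exI[of _ "u # xs"]) (auto simp: successively_Cons)
    qed
  qed
  then show ?thesis using that by blast
qed

lemma nonseparable_in_block:
  assumes "finite V" "nonseparable E B" "B \<subseteq> V"
  obtains D where "is_block V E D" "B \<subseteq> D"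
proof -
  let ?\<C> = "{C. B \<subseteq> C \<and> C \<subseteq> V \<and> nonseparable E C}"
  have fin: "finite ?\<C>" by (rule finite_subset[of _ "Pow V"]) (use assms(1) in auto)
  have B: "B \<in> ?\<C>" using assms by simp
  obtain D where D: "D \<in> ?\<C>" "\<forall>C\<in>?\<C>. D \<subseteq> C \<longrightarrow> D = C"
    using finite_has_maximal2[OF fin B] by (elim bexE conjE)
  then have "is_block V E D" "B \<subseteq> D" unfolding is_block_def by auto
  then show ?thesis by (rule that)
qed

lemma odd_clique_tree_connected_on: "odd_clique_tree E S \<B> \<Longrightarrow> connected_on E S"
proof (induction rule: odd_clique_tree.induct)
  case (single v)
  then show ?case by (simp add: connected_on_def)
next
  case (glue S \<B> D a)
  then show ?case
    using connected_on_Un[OF glue.IH complete_on_connected_on[OF glue.hyps(2)]] by blast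
qed

text \<open>A maximal odd clique tree whose recorded cliques are blocks of the whole graph is taken.
  An edge leaving it lies in a block \<open>D\<close>, which can be glued on, against
  maximality.\<close>

lemma odd_clique_tree_if_blocks:
  assumes fin: "finite V" and ne: "V \<noteq> {}" and con: "connected_on E V"
    and blocks: "\<And>B. is_block V E B \<Longrightarrow> complete_on E B \<and> odd (card B)"
  shows "\<exists>\<B>. odd_clique_tree E V \<B>"
proof -
  define good where "good S \<longleftrightarrow> S \<subseteq> V \<and> (\<exists>\<B>. odd_clique_tree E S \<B> \<and> (\<forall>D\<in>\<B>. is_block V E D))" for S
  obtain v where "v \<in> V" using ne by blast
  then have "good {v}" unfolding good_def using odd_clique_tree.single[of E v] by auto
  moreover have "finite (Collect good)"
    by (rule finite_subset[of _ "Pow V"]) (use fin in \<open>auto simp: good_def\<close>)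
  ultimately obtain S where S: "good S" and max: "\<And>S'. good S' \<Longrightarrow> S \<subseteq> S' \<Longrightarrow> S = S'"
    using finite_has_maximal2[of "Collect good" "{v}"] by (metis mem_Collect_eq)
  obtain \<B> where T: "odd_clique_tree E S \<B>" and bl: "\<And>D. D \<in> \<B> \<Longrightarrow> is_block V E D" and SV: "S \<subseteq> V"
    using S unfolding good_def by blast
  have "S = V"
  proof (rule ccontr)
    assume "S \<noteq> V"
    moreover have "S \<noteq> {}" using odd_clique_tree_finite[OF T] by blast
    ultimately obtain s u where su: "s \<in> S" "u \<in> V" "u \<notin> S" "E s u"
      using connected_on_crossing_edge[OF con SV] by blast
    have su': "nonseparable E {s, u}" "{s, u} \<subseteq> V"
      using complete_on_nonseparable[OF edge_complete_on[OF su(4)]] su SV by auto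
    obtain D where "is_block V E D" "{s, u} \<subseteq> D"
      using nonseparable_in_block[OF fin su'] .
    then have D: "is_block V E D" "s \<in> D" "u \<in> D" by auto
    have DV: "D \<subseteq> V" "nonseparable E D" using D(1) unfolding is_block_def by auto
    have maxD: "C \<subseteq> D" if "nonseparable E (D \<union> C)" "C \<subseteq> V" for C
      using D(1) that DV(1) unfolding is_block_def by blast
    have cD: "complete_on E D" "odd (card D)" using blocks[OF D(1)] by auto
    \<comment> \<open>A second common vertex \<open>t\<close> is adjacent to \<open>s\<close>, so
      both lie in a recorded clique. That clique is a block sharing two vertices with
      \<open>D\<close>, so it absorbs \<open>D\<close> and with it \<open>u\<close>, which is
      outside \<open>S\<close>.\<close>
    have DS: "D \<inter> S = {s}"
    proof (rule ccontr)
      assume "D \<inter> S \<noteq> {s}"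
      then obtain t where t: "t \<in> D" "t \<in> S" "t \<noteq> s" using D su by blast
      then have "E s t" using cD(1) D(2) unfolding complete_on_def by auto
      then obtain D' where D': "D' \<in> \<B>" "s \<in> D'" "t \<in> D'"
        using odd_clique_tree_edge_block[OF T su(1) t(2)] by blast
      have b': "D' \<subseteq> V" "nonseparable E D'" "\<And>C. D' \<subseteq> C \<Longrightarrow> C \<subseteq> V \<Longrightarrow> nonseparable E C \<Longrightarrow> C = D'"
        using bl[OF D'(1)] unfolding is_block_def by auto
      have "nonseparable E (D' \<union> D)"
        using D(2) t D' by (intro nonseparable_Un[OF b'(2) DV(2), of s t]) auto
      then have "D' \<union> D = D'" using b'(1) DV(1) by (intro b'(3)) auto
      then have "u \<in> D'" using D(3) by auto
      then show False using odd_clique_tree_blockD[OF T D'(1)] su(3) by auto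
    qed
    \<comment> \<open>A path from \<open>s\<close> to \<open>t\<close> inside \<open>S\<close>,
      continued to \<open>d\<close>, would be an ear of \<open>D\<close>, and maximality of
      \<open>D\<close> would put \<open>t\<close> into \<open>D\<close>.\<close>
    have nE: "\<not> E d t" if d: "d \<in> D - {s}" and t: "t \<in> S - {s}" for d t
    proof
      assume "E d t"
      then have td: "E t d" by (rule sym)
      obtain xs where xs: "distinct xs" "successively E xs" "xs \<noteq> []" "hd xs = s" "last xs = t" "set xs \<subseteq> S"
        using connected_on_path[OF odd_clique_tree_connected_on[OF T] su(1)] t by (metis DiffD1)
      have "d \<notin> S" using d DS by blast
      then have "nonseparable E (D \<union> set (xs @ [d]))"
        using xs td d D(2) DV(2) by (intro nonseparable_Un_ear) (auto simp: successively_append_iff)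
      then have "set (xs @ [d]) \<subseteq> D" using xs(6) SV d DV(1) by (intro maxD) auto
      then have "t \<in> D" using xs(3,5) by auto
      then show False using t DS by blast
    qed
    have "card D \<ge> 3"
    proof -
      have "finite D" using DV fin finite_subset by blast
      then have "card {s, u} \<le> card D" using D by (intro card_mono) auto
      moreover have "s \<noteq> u" using su(1,3) by blast
      then have "card {s, u} = 2" by simp
      ultimately show ?thesis using cD(2) by (cases "card D = 2") auto
    qed
    then have "odd_clique_tree E (S \<union> D) (insert D \<B>)"
      using odd_clique_tree.glue[OF T cD _ DS nE] by blast
    moreover have "\<forall>C\<in>insert D \<B>. is_block V E C" using D(1) bl by auto
    ultimately have "good (S \<union> D)" unfolding good_def using SV DV(1) by (intro conjI exI) auto
    then have "S = S \<union> D" by (rule max) simp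
    then show False using su(3) D(3) by auto
  qed
  then show ?thesis using T by blast
qed

end

theorem mainTheorem1:
  fixes V :: "'a set" and E :: "'a \<Rightarrow> 'a \<Rightarrow> bool"
  assumes "simple_graph V E"
    and "connected_graph V E"
    and "claw_free V E"
  shows "has_IPD V E \<longleftrightarrow>
         (\<exists>B. is_block V E B \<and> \<not> (complete_on E B \<and> odd (card B)))"
proof -
  interpret sym_irrefl E
    using assms(1) unfolding simple_graph_def by unfold_locales blast+
  have V: "finite V" "V \<noteq> {}" "connected_on E V"
    using assms(1,2) unfolding simple_graph_def connected_graph_def by blast+
  show ?thesis
  proof
    assume "has_IPD V E"
    then show "\<exists>B. is_block V E B \<and> \<not> (complete_on E B \<and> odd (card B))"
      using odd_clique_tree_if_blocks[OF V] odd_clique_tree_no_IPD by metis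
  next
    assume "\<exists>B. is_block V E B \<and> \<not> (complete_on E B \<and> odd (card B))"
    then show "has_IPD V E"
      using claw_free_has_IPD_or_tree[OF V assms(3)] odd_clique_tree_block by metis
  qed
qed

end
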